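(* Let $\mathcal{C}$ be a complete category, and let $(\mathbb{E},\mathbb{M})$ be a factorization system on $\mathcal{C}$ such that every morphism in $\mathbb{E}$ is an epimorphism. Let $\mathcal{C}$ be $\mathbb{E}$-co-well-powered, and let $\mathcal{X}$ be a full replete subcategory of $\mathcal{C}$. The following conditions are equivalent: (i) $\mathcal{X}$ is closed under products and $\mathbb{M}$-subobjects (the latter means that if a morphism $m:X\to X'$ lies in $\mathbb{M}$ and $X'$ is an object of $\mathcal{X}$, then $X$ is also an object of $\mathcal{X}$); (ii) $\mathcal{X}$ is a reflective subcategory of $\mathcal{C}$, and the components of the reflection unit lie in $\mathbb{E}$; (iii) $\mathcal{X}$ is a reflective subcategory of $\mathcal{C}$ and is closed under $\mathbb{M}$-subobjects.
   Context: A factorization system $(\mathbb{E},\mathbb{M})$ on $\mathcal{C}$ is an (orthogonal) factorization system: $\mathbb{E}$ and $\mathbb{M}$ are classes of morphisms that contain the isomorphisms and are closed under composition, every morphism factors as $me$ with $e\in\mathbb{E}$, $m\in\mathbb{M}$, and for every commutative square $ge=mf$ with $e\in\mathbb{E}$, $m\in\mathbb{M}$ there is a unique $d$ with $de=f$ and $md=g$. Two $\mathbb{E}$-morphisms $e:C\to D$, $e':C\to D'$ with the same domain are equivalent if there is an isomorphism $h:D\to D'$ with $he=e'$; $\mathcal{C}$ is $\mathbb{E}$-co-well-powered if, for each object $C$, the equivalence classes of $\mathbb{E}$-morphisms with domain $C$ form a set. A subcategory is replete if it is closed under isomorphic objects; "products" means small products. A full subcategory is reflective if its inclusion functor has a left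 adjoint; the reflection unit is the unit of this adjunction. *)

theory Defs
  imports "HOL-Library.Equipollence"
begin

text \<open>
  Objects and arrows live in arbitrary types, so a category here may be large; in particular no
  local smallness is built in. Only the values of the operations on objects, on arrows and on
  composable pairs matter. \<open>g \<cdot>\<^bsub>C\<^esub> f\<close> is ``first \<open>f\<close>, then \<open>g\<close>''.
\<close>

record ('o, 'a) cat =
  Obj :: "'o set"
  Arr :: "'a set"
  Dom :: "'a \<Rightarrow> 'o"
  Cod :: "'a \<Rightarrow> 'o"
  Ident :: "'o \<Rightarrow> 'a"
  Comp :: "'a \<Rightarrow> 'a \<Rightarrow> 'a"  (infixl "\<cdot>\<index>" 70)

definition Hom :: "('o, 'a) cat \<Rightarrow> 'o \<Rightarrow> 'o \<Rightarrow> 'a set" where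
  "Hom C A B = {f \<in> Arr C. Dom C f = A \<and> Cod C f = B}"

locale category =
  fixes C :: "('o, 'a) cat" (structure)
  assumes Dom_in_Obj: "f \<in> Arr C \<Longrightarrow> Dom C f \<in> Obj C"
    and Cod_in_Obj: "f \<in> Arr C \<Longrightarrow> Cod C f \<in> Obj C"
    and Ident_in_Hom: "A \<in> Obj C \<Longrightarrow> Ident C A \<in> Hom C A A"
    and Comp_in_Hom: "\<lbrakk>f \<in> Hom C A B; g \<in> Hom C B D\<rbrakk> \<Longrightarrow> g \<cdot> f \<in> Hom C A D"
    and Comp_Ident_right: "f \<in> Hom C A B \<Longrightarrow> f \<cdot> Ident C A = f"
    and Comp_Ident_left: "f \<in> Hom C A B \<Longrightarrow> Ident C B \<cdot> f = f"
    and Comp_assoc: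
      "\<lbrakk>f \<in> Hom C A B; g \<in> Hom C B D; h \<in> Hom C D K\<rbrakk> \<Longrightarrow> (h \<cdot> g) \<cdot> f = h \<cdot> (g \<cdot> f)"

definition is_iso :: "('o, 'a) cat \<Rightarrow> 'a \<Rightarrow> bool" where
  "is_iso C f \<longleftrightarrow> f \<in> Arr C \<and>
     (\<exists>g \<in> Hom C (Cod C f) (Dom C f).
        g \<cdot>\<^bsub>C\<^esub> f = Ident C (Dom C f) \<and> f \<cdot>\<^bsub>C\<^esub> g = Ident C (Cod C f))"

definition is_epi :: "('o, 'a) cat \<Rightarrow> 'a \<Rightarrow> bool" where
  "is_epi C e \<longleftrightarrow> e \<in> Arr C \<and>
     (\<forall>B. \<forall>g \<in> Hom C (Cod C e) B. \<forall>h \<in> Hom C (Cod C e) B.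
        g \<cdot>\<^bsub>C\<^esub> e = h \<cdot>\<^bsub>C\<^esub> e \<longrightarrow> g = h)"


record ('o, 'a, 'p, 'b) funct =
  OMap :: "'o \<Rightarrow> 'p"
  AMap :: "'a \<Rightarrow> 'b"

definition is_functor ::
  "('o, 'a) cat \<Rightarrow> ('p, 'b) cat \<Rightarrow> ('o, 'a, 'p, 'b) funct \<Rightarrow> bool" where
  "is_functor C D F \<longleftrightarrow>
     (\<forall>A \<in> Obj C. OMap F A \<in> Obj D) \<and>
     (\<forall>A B. \<forall>f \<in> Hom C A B. AMap F f \<in> Hom D (OMap F A) (OMap F B)) \<and>
     (\<forall>A \<in> Obj C. AMap F (Ident C A) = Ident D (OMap F A)) \<and>
     (\<forall>A B K. \<forall>f \<in> Hom C A B. \<forall>g \<in> Hom C B K.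
        AMap F (g \<cdot>\<^bsub>C\<^esub> f) = AMap F g \<cdot>\<^bsub>D\<^esub> AMap F f)"

definition functor_comp ::
  "('p, 'b, 'q, 'c) funct \<Rightarrow> ('o, 'a, 'p, 'b) funct \<Rightarrow> ('o, 'a, 'q, 'c) funct" where
  "functor_comp G F = \<lparr>OMap = OMap G \<circ> OMap F, AMap = AMap G \<circ> AMap F\<rparr>"

text \<open>Serves both as identity functor and as inclusion functor of a subcategory.\<close>

definition incl_functor :: "('o, 'a, 'o, 'a) funct" where
  "incl_functor = \<lparr>OMap = (\<lambda>A. A), AMap = (\<lambda>f. f)\<rparr>"

definition nat_trans ::
  "('o, 'a) cat \<Rightarrow> ('p, 'b) cat \<Rightarrow> ('o, 'a, 'p, 'b) funct \<Rightarrow> ('o, 'a, 'p, 'b) funct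
     \<Rightarrow> ('o \<Rightarrow> 'b) \<Rightarrow> bool" where
  "nat_trans C D F G \<tau> \<longleftrightarrow>
     (\<forall>A \<in> Obj C. \<tau> A \<in> Hom D (OMap F A) (OMap G A)) \<and>
     (\<forall>A B. \<forall>f \<in> Hom C A B. \<tau> B \<cdot>\<^bsub>D\<^esub> AMap F f = AMap G f \<cdot>\<^bsub>D\<^esub> \<tau> A)"

text \<open>\<open>F : C \<rightarrow> D\<close> is left adjoint to \<open>G : D \<rightarrow> C\<close> with unit \<open>\<eta>\<close> and counit \<open>\<epsilon>\<close>.\<close>

definition adjunction ::
  "('o, 'a) cat \<Rightarrow> ('p, 'b) cat \<Rightarrow> ('o, 'a, 'p, 'b) funct \<Rightarrow> ('p, 'b, 'o, 'a) funct
     \<Rightarrow> ('o \<Rightarrow> 'a) \<Rightarrow> ('p \<Rightarrow> 'b) \<Rightarrow> bool" where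
  "adjunction C D F G \<eta> \<epsilon> \<longleftrightarrow>
     is_functor C D F \<and> is_functor D C G \<and>
     nat_trans C C incl_functor (functor_comp G F) \<eta> \<and>
     nat_trans D D (functor_comp F G) incl_functor \<epsilon> \<and>
     (\<forall>A \<in> Obj C. \<epsilon> (OMap F A) \<cdot>\<^bsub>D\<^esub> AMap F (\<eta> A) = Ident D (OMap F A)) \<and>
     (\<forall>B \<in> Obj D. AMap G (\<epsilon> B) \<cdot>\<^bsub>C\<^esub> \<eta> (OMap G B) = Ident C (OMap G B))"


text \<open>A full subcategory is given by its set of objects \<open>X \<subseteq> Obj C\<close>.\<close>

definition full_subcat :: "('o, 'a) cat \<Rightarrow> 'o set \<Rightarrow> ('o, 'a) cat" where
  "full_subcat C X = C\<lparr>Obj := X, Arr := {f \<in> Arr C. Dom C f \<in> X \<and> Cod C f \<in> X}\<rparr>"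

definition replete :: "('o, 'a) cat \<Rightarrow> 'o set \<Rightarrow> bool" where
  "replete C X \<longleftrightarrow> (\<forall>f. is_iso C f \<longrightarrow> Dom C f \<in> X \<longrightarrow> Cod C f \<in> X)"

definition reflection ::
  "('o, 'a) cat \<Rightarrow> 'o set \<Rightarrow> ('o, 'a, 'o, 'a) funct \<Rightarrow> ('o \<Rightarrow> 'a) \<Rightarrow> ('o \<Rightarrow> 'a) \<Rightarrow> bool" where
  "reflection C X L \<eta> \<epsilon> \<longleftrightarrow> adjunction C (full_subcat C X) L incl_functor \<eta> \<epsilon>"

definition reflective :: "('o, 'a) cat \<Rightarrow> 'o set \<Rightarrow> bool" where
  "reflective C X \<longleftrightarrow> (\<exists>L \<eta> \<epsilon>. reflection C X L \<eta> \<epsilon>)"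


text \<open>
  HOL has no built-in distinction between sets and classes, so smallness is taken relative to a
  type \<open>'u\<close>: a set is small if its cardinality is less than that of \<open>'u\<close>. When the cardinality of
  \<open>'u\<close> is inaccessible, these are, up to bijection, the elements of a Grothendieck universe, and
  the notions below are the usual ones for that universe. Nothing depends on inaccessibility,
  so \<open>'u\<close> is left arbitrary. Every small set is in bijection with a small subset of \<open>'u\<close>; hence
  it suffices to index diagrams by subsets of \<open>'u\<close>.
\<close>

definition small :: "'u itself \<Rightarrow> 's set \<Rightarrow> bool" where
  "small U S \<longleftrightarrow> S \<prec> (UNIV :: 'u set)"

definition is_cone ::
  "('i, 'j) cat \<Rightarrow> ('o, 'a) cat \<Rightarrow> ('i, 'j, 'o, 'a) funct \<Rightarrow> 'o \<Rightarrow> ('i \<Rightarrow> 'a) \<Rightarrow> bool" where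
  "is_cone J C D V p \<longleftrightarrow> V \<in> Obj C \<and>
     (\<forall>i \<in> Obj J. p i \<in> Hom C V (OMap D i)) \<and>
     (\<forall>u \<in> Arr J. AMap D u \<cdot>\<^bsub>C\<^esub> p (Dom J u) = p (Cod J u))"

definition is_limit ::
  "('i, 'j) cat \<Rightarrow> ('o, 'a) cat \<Rightarrow> ('i, 'j, 'o, 'a) funct \<Rightarrow> 'o \<Rightarrow> ('i \<Rightarrow> 'a) \<Rightarrow> bool" where
  "is_limit J C D V p \<longleftrightarrow> is_cone J C D V p \<and>
     (\<forall>W q. is_cone J C D W q \<longrightarrow>
        (\<exists>!h. h \<in> Hom C W V \<and> (\<forall>i \<in> Obj J. p i \<cdot>\<^bsub>C\<^esub> h = q i)))"

definition complete_category :: "'u itself \<Rightarrow> ('o, 'a) cat \<Rightarrow> bool" where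
  "complete_category U C \<longleftrightarrow> category C \<and>
     (\<forall>(J :: ('u, 'u) cat) D.
        category J \<and> small U (Obj J) \<and> small U (Arr J) \<and> is_functor J C D \<longrightarrow>
        (\<exists>V p. is_limit J C D V p))"

definition is_product ::
  "('o, 'a) cat \<Rightarrow> 'i set \<Rightarrow> ('i \<Rightarrow> 'o) \<Rightarrow> 'o \<Rightarrow> ('i \<Rightarrow> 'a) \<Rightarrow> bool" where
  "is_product C I F P p \<longleftrightarrow> P \<in> Obj C \<and>
     (\<forall>i \<in> I. p i \<in> Hom C P (F i)) \<and>
     (\<forall>W \<in> Obj C. \<forall>q. (\<forall>i \<in> I. q i \<in> Hom C W (F i)) \<longrightarrow>
        (\<exists>!h. h \<in> Hom C W P \<and> (\<forall>i \<in> I. p i \<cdot>\<^bsub>C\<^esub> h = q i)))"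

definition closed_under_products :: "'u itself \<Rightarrow> ('o, 'a) cat \<Rightarrow> 'o set \<Rightarrow> bool" where
  "closed_under_products U C X \<longleftrightarrow>
     (\<forall>(I :: 'u set) F P p.
        small U I \<and> (\<forall>i \<in> I. F i \<in> X) \<and> is_product C I F P p \<longrightarrow> P \<in> X)"

definition closed_under_subobjects :: "('o, 'a) cat \<Rightarrow> 'a set \<Rightarrow> 'o set \<Rightarrow> bool" where
  "closed_under_subobjects C M X \<longleftrightarrow> (\<forall>m \<in> M. Cod C m \<in> X \<longrightarrow> Dom C m \<in> X)"


definition factorization_system :: "('o, 'a) cat \<Rightarrow> 'a set \<Rightarrow> 'a set \<Rightarrow> bool" where
  "factorization_system C E M \<longleftrightarrow>
     E \<subseteq> Arr C \<and> M \<subseteq> Arr C \<and>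
     (\<forall>f. is_iso C f \<longrightarrow> f \<in> E \<and> f \<in> M) \<and>
     (\<forall>f \<in> E. \<forall>g \<in> E. Cod C f = Dom C g \<longrightarrow> g \<cdot>\<^bsub>C\<^esub> f \<in> E) \<and>
     (\<forall>f \<in> M. \<forall>g \<in> M. Cod C f = Dom C g \<longrightarrow> g \<cdot>\<^bsub>C\<^esub> f \<in> M) \<and>
     (\<forall>f \<in> Arr C. \<exists>e \<in> E. \<exists>m \<in> M. Cod C e = Dom C m \<and> f = m \<cdot>\<^bsub>C\<^esub> e) \<and>
     (\<forall>e \<in> E. \<forall>m \<in> M.
        \<forall>f \<in> Hom C (Dom C e) (Dom C m). \<forall>g \<in> Hom C (Cod C e) (Cod C m).
        g \<cdot>\<^bsub>C\<^esub> e = m \<cdot>\<^bsub>C\<^esub> f \<longrightarrow>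
        (\<exists>!d. d \<in> Hom C (Cod C e) (Dom C m) \<and> d \<cdot>\<^bsub>C\<^esub> e = f \<and> m \<cdot>\<^bsub>C\<^esub> d = g))"

definition morphisms_from :: "('o, 'a) cat \<Rightarrow> 'a set \<Rightarrow> 'o \<Rightarrow> 'a set" where
  "morphisms_from C E A = {e \<in> E. Dom C e = A}"

definition quotient_equiv :: "('o, 'a) cat \<Rightarrow> 'a set \<Rightarrow> 'o \<Rightarrow> ('a \<times> 'a) set" where
  "quotient_equiv C E A =
     {(e, e'). e \<in> morphisms_from C E A \<and> e' \<in> morphisms_from C E A \<and>
        (\<exists>h \<in> Hom C (Cod C e) (Cod C e'). is_iso C h \<and> h \<cdot>\<^bsub>C\<^esub> e = e')}"

definition co_well_powered :: "'u itself \<Rightarrow> ('o, 'a) cat \<Rightarrow> 'a set \<Rightarrow> bool" where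
  "co_well_powered U C E \<longleftrightarrow>
     (\<forall>A \<in> Obj C. small U (morphisms_from C E A // quotient_equiv C E A))"

end

theory Submission
  imports Defs
begin

text \<open>
  A reflection is the same thing as a choice of a universal arrow \<open>r : A \<rightarrow> R\<close> with \<open>R\<close> in \<open>X\<close> for
  each object \<open>A\<close>. From (i), pair up representatives of the \<open>E\<close>-quotients of \<open>A\<close>
  with codomain in \<open>X\<close> into a morphism from \<open>A\<close> to their product; its \<open>E\<close>-part is universal,
  since every \<open>A \<rightarrow> Y\<close> with \<open>Y\<close> in \<open>X\<close> factors through its own \<open>E\<close>-part, hence through one of the
  representatives. From (ii), the unit at a product, or at an \<open>M\<close>-subobject, of objects of \<open>X\<close> has
  a left inverse, and a universal arrow with a left inverse is invertible. From (iii), the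
  \<open>M\<close>-part of the unit is invertible.
\<close>

section \<open>Full subcategories, and universal arrows into them\<close>

lemma full_subcat_simps [simp]:
  "Obj (full_subcat C X) = X"
  "Dom (full_subcat C X) = Dom C"
  "Cod (full_subcat C X) = Cod C"
  "Ident (full_subcat C X) = Ident C"
  "Comp (full_subcat C X) = Comp C"
  by (simp_all add: full_subcat_def)

lemma Hom_full_subcat [simp]:
  "f \<in> Hom (full_subcat C X) A B \<longleftrightarrow> f \<in> Hom C A B \<and> A \<in> X \<and> B \<in> X"
  by (auto simp: Hom_def full_subcat_def)

lemma incl_functor_simps [simp]:
  "OMap incl_functor A = A"
  "AMap incl_functor f = f"
  by (simp_all add: incl_functor_def)

lemma functor_comp_simps [simp]:
  "OMap (functor_comp G F) A = OMap G (OMap F A)"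
  "AMap (functor_comp G F) f = AMap G (AMap F f)"
  by (simp_all add: functor_comp_def)

text \<open>This is an initial object of the comma category from \<open>A\<close> to the inclusion
  of \<open>X\<close>, with its target read off as \<open>Cod C r\<close>. It describes a left
  adjoint object by object, with no functor or naturality involved.\<close>

definition universal_arrow :: "('o, 'a) cat \<Rightarrow> 'o set \<Rightarrow> 'o \<Rightarrow> 'a \<Rightarrow> bool" where
  "universal_arrow C X A r \<longleftrightarrow> r \<in> Hom C A (Cod C r) \<and> Cod C r \<in> X \<and>
     (\<forall>Y \<in> X. \<forall>f \<in> Hom C A Y. \<exists>!g. g \<in> Hom C (Cod C r) Y \<and> g \<cdot>\<^bsub>C\<^esub> r = f)"

text \<open>The extension of \<open>f\<close> along \<open>r\<close>; the description is proper when
  \<open>r\<close> is universal and \<open>f\<close> ends in \<open>X\<close>.\<close>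

definition universal_lift :: "('o, 'a) cat \<Rightarrow> 'a \<Rightarrow> 'a \<Rightarrow> 'a" where
  "universal_lift C r f = (THE g. g \<in> Hom C (Cod C r) (Cod C f) \<and> g \<cdot>\<^bsub>C\<^esub> r = f)"

lemma universal_arrow_Hom: "universal_arrow C X A r \<Longrightarrow> r \<in> Hom C A (Cod C r)"
  and universal_arrow_Cod: "universal_arrow C X A r \<Longrightarrow> Cod C r \<in> X"
  by (auto simp: universal_arrow_def)

lemma universal_lift:
  assumes "universal_arrow C X A r" "f \<in> Hom C A Y" "Y \<in> X"
  shows "universal_lift C r f \<in> Hom C (Cod C r) Y" "universal_lift C r f \<cdot>\<^bsub>C\<^esub> r = f"
proof -
  have "\<exists>!g. g \<in> Hom C (Cod C r) (Cod C f) \<and> g \<cdot>\<^bsub>C\<^esub> r = f"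
    using assms by (auto simp: universal_arrow_def Hom_def)
  from theI'[OF this] show "universal_lift C r f \<in> Hom C (Cod C r) Y" "universal_lift C r f \<cdot>\<^bsub>C\<^esub> r = f"
    using assms by (auto simp: universal_lift_def Hom_def)
qed

text \<open>Uniqueness of the extension is applied to the composite \<open>g \<cdot> r\<close>
  itself. That this composite is an arrow from \<open>A\<close> to \<open>Y\<close> is assumed
  because the axioms of a category are not in force here.\<close>

lemma universal_arrow_cancel:
  assumes "universal_arrow C X A r" "Y \<in> X" "g \<in> Hom C (Cod C r) Y" "h \<in> Hom C (Cod C r) Y"
    and "g \<cdot>\<^bsub>C\<^esub> r \<in> Hom C A Y" "g \<cdot>\<^bsub>C\<^esub> r = h \<cdot>\<^bsub>C\<^esub> r"
  shows "g = h"
proof -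
  have "\<exists>!k. k \<in> Hom C (Cod C r) Y \<and> k \<cdot>\<^bsub>C\<^esub> r = g \<cdot>\<^bsub>C\<^esub> r"
    using assms(1,2,5) by (simp add: universal_arrow_def)
  then show ?thesis using assms(3,4,6) by (auto elim!: alt_ex1E)
qed

section \<open>Reflections as universal arrows, their closure properties, and products\<close>

context category
begin

lemma Hom_Obj: "f \<in> Hom C A B \<Longrightarrow> A \<in> Obj C" "f \<in> Hom C A B \<Longrightarrow> B \<in> Obj C"
  using Dom_in_Obj Cod_in_Obj by (auto simp: Hom_def)

lemma isoI:
  assumes "f \<in> Hom C A B" "g \<in> Hom C B A" "g \<cdot> f = Ident C A" "f \<cdot> g = Ident C B"
  shows "is_iso C f" "is_iso C g"
  using assms by (auto simp: is_iso_def Hom_def)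

lemma epi_cancel:
  assumes "is_epi C e" "e \<in> Hom C A B" "g \<in> Hom C B D" "h \<in> Hom C B D" "g \<cdot> e = h \<cdot> e"
  shows "g = h"
  using assms by (auto simp: is_epi_def Hom_def)

text \<open>The extension of \<open>f\<close> is its transpose
  \<open>\<epsilon> Y \<cdot> AMap L f\<close>. Naturality of \<eta> and the triangle identity at
  \<open>Y\<close> show that it extends \<open>f\<close>; naturality of \<epsilon> and the triangle
  identity at \<open>A\<close> show that it is the only one.\<close>

lemma reflection_imp_universal_arrow:
  assumes "reflection C X L \<eta> \<epsilon>" "A \<in> Obj C"
  shows "universal_arrow C X A (\<eta> A)"
proof -
  let ?D = "full_subcat C X"
  have adj: "is_functor C ?D L" "nat_trans C C incl_functor (functor_comp incl_functor L) \<eta>"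
     "nat_trans ?D ?D (functor_comp L incl_functor) incl_functor \<epsilon>"
     and tri: "\<And>A. A \<in> Obj C \<Longrightarrow> \<epsilon> (OMap L A) \<cdot> AMap L (\<eta> A) = Ident C (OMap L A)"
     "\<And>B. B \<in> X \<Longrightarrow> \<epsilon> B \<cdot> \<eta> B = Ident C B"
    using assms(1) by (simp_all add: reflection_def adjunction_def)
  have \<eta>: "\<eta> B \<in> Hom C B (OMap L B)" if "B \<in> Obj C" for B
    using adj(2) that by (simp add: nat_trans_def)
  have \<eta>_nat: "\<eta> D \<cdot> f = AMap L f \<cdot> \<eta> B" if "f \<in> Hom C B D" for f B D
    using adj(2) that by (simp add: nat_trans_def)
  have \<epsilon>: "\<epsilon> B \<in> Hom C (OMap L B) B" if "B \<in> X" for B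
    using adj(3) that by (simp add: nat_trans_def)
  have \<epsilon>_nat: "\<epsilon> D \<cdot> AMap L f = f \<cdot> \<epsilon> B" if "f \<in> Hom C B D" "B \<in> X" "D \<in> X" for f B D
    using adj(3) that by (simp add: nat_trans_def)
  have LO: "OMap L B \<in> X" if "B \<in> Obj C" for B
    using adj(1) that by (simp add: is_functor_def)
  have LA: "AMap L f \<in> Hom C (OMap L B) (OMap L D)" if "f \<in> Hom C B D" for f B D
    using adj(1) that by (simp add: is_functor_def)
  have LC: "AMap L (g \<cdot> f) = AMap L g \<cdot> AMap L f" if "f \<in> Hom C B D" "g \<in> Hom C D K" for f g B D K
    using adj(1) that unfolding is_functor_def by (metis full_subcat_simps(5))
  have \<eta>A: "\<eta> A \<in> Hom C A (OMap L A)" and LX: "OMap L A \<in> X" using \<eta> LO assms(2) by auto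
  have Cod: "Cod C (\<eta> A) = OMap L A" using \<eta>A by (simp add: Hom_def)
  have "\<exists>!g. g \<in> Hom C (OMap L A) Y \<and> g \<cdot> \<eta> A = f" if Y: "Y \<in> X" and f: "f \<in> Hom C A Y" for Y f
  proof (rule ex1I[of _ "\<epsilon> Y \<cdot> AMap L f"], intro conjI)
    show "\<epsilon> Y \<cdot> AMap L f \<in> Hom C (OMap L A) Y"
      using Comp_in_Hom LA[OF f] \<epsilon>[OF Y] by blast
    have "\<epsilon> Y \<cdot> AMap L f \<cdot> \<eta> A = \<epsilon> Y \<cdot> (\<eta> Y \<cdot> f)"
      using Comp_assoc[OF \<eta>A LA[OF f] \<epsilon>[OF Y]] \<eta>_nat[OF f] by simp
    also have "\<dots> = \<epsilon> Y \<cdot> \<eta> Y \<cdot> f"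
      using Comp_assoc[OF f \<eta>[OF Hom_Obj(2)[OF f]] \<epsilon>[OF Y]] by simp
    also have "\<dots> = f" using tri(2)[OF Y] Comp_Ident_left[OF f] by simp
    finally show "\<epsilon> Y \<cdot> AMap L f \<cdot> \<eta> A = f" .
  next
    fix g assume "g \<in> Hom C (OMap L A) Y \<and> g \<cdot> \<eta> A = f"
    then have g: "g \<in> Hom C (OMap L A) Y" and gf: "f = g \<cdot> \<eta> A" by auto
    have "\<epsilon> Y \<cdot> AMap L f = \<epsilon> Y \<cdot> AMap L g \<cdot> AMap L (\<eta> A)"
      using Comp_assoc[OF LA[OF \<eta>A] LA[OF g] \<epsilon>[OF Y]] LC[OF \<eta>A g] gf by simp
    \<comment> \<open>Naturality of \<epsilon> applies to \<open>g\<close> by fullness: both of its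
      ends lie in \<open>X\<close>.\<close>
    also have "\<dots> = g \<cdot> (\<epsilon> (OMap L A) \<cdot> AMap L (\<eta> A))"
      using Comp_assoc[OF LA[OF \<eta>A] \<epsilon>[OF LX] g] \<epsilon>_nat[OF g LX Y] by simp
    also have "\<dots> = g" using tri(1)[OF assms(2)] Comp_Ident_right[OF g] by simp
    finally show "g = \<epsilon> Y \<cdot> AMap L f" by simp
  qed
  then show ?thesis using \<eta>A LX by (simp add: universal_arrow_def Cod)
qed

text \<open>Equations between maps out of \<open>OMap L A\<close> are checked after composing with
  \<open>\<eta> A\<close>. The given family \<eta> is itself the unit, so properties of its members
  pass to the reflection.\<close>

lemma universal_arrows_imp_reflection:
  assumes X: "X \<subseteq> Obj C" and \<eta>: "\<And>A. A \<in> Obj C \<Longrightarrow> universal_arrow C X A (\<eta> A)"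
  shows "\<exists>L \<epsilon>. reflection C X L \<eta> \<epsilon>"
proof -
  \<comment> \<open>On arrows, \<open>L\<close> takes \<open>f\<close> from \<open>A\<close> to
    \<open>B\<close> to the extension of \<open>\<eta> B \<cdot> f\<close> along
    \<open>\<eta> A\<close>, which makes \<eta> natural.\<close>
  define L where "L = \<lparr>OMap = (\<lambda>A. Cod C (\<eta> A)),
    AMap = (\<lambda>f. universal_lift C (\<eta> (Dom C f)) (\<eta> (Cod C f) \<cdot> f))\<rparr>"
  \<comment> \<open>The counit extends the identity of \<open>B\<close> along
    \<open>\<eta> B\<close>, which is one triangle identity.\<close>
  define \<epsilon> where "\<epsilon> = (\<lambda>B. universal_lift C (\<eta> B) (Ident C B))"
  have \<eta>H: "\<eta> A \<in> Hom C A (OMap L A)" if "A \<in> Obj C" for A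
    using universal_arrow_Hom[OF \<eta>[OF that]] by (simp add: L_def)
  have LO: "OMap L A \<in> X" if "A \<in> Obj C" for A
    using universal_arrow_Cod[OF \<eta>[OF that]] by (simp add: L_def)
  have LO': "OMap L A \<in> Obj C" if "A \<in> Obj C" for A using LO[OF that] X by blast
  have LA: "AMap L f \<in> Hom C (OMap L A) (OMap L B)" "AMap L f \<cdot> \<eta> A = \<eta> B \<cdot> f"
    if f: "f \<in> Hom C A B" for f A B
  proof -
    note O = Hom_Obj[OF f]
    show "AMap L f \<in> Hom C (OMap L A) (OMap L B)" "AMap L f \<cdot> \<eta> A = \<eta> B \<cdot> f"
      using universal_lift[OF \<eta>[OF O(1)] Comp_in_Hom[OF f \<eta>H[OF O(2)]] LO[OF O(2)]] f
      by (auto simp: L_def Hom_def)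
  qed
  have \<epsilon>H: "\<epsilon> B \<in> Hom C (OMap L B) B" "\<epsilon> B \<cdot> \<eta> B = Ident C B" if "B \<in> X" for B
    using universal_lift[OF \<eta> Ident_in_Hom that] that X by (auto simp: L_def \<epsilon>_def)
  have eqI: "g = h" if "A \<in> Obj C" "Y \<in> X" "g \<in> Hom C (OMap L A) Y" "h \<in> Hom C (OMap L A) Y"
     "g \<cdot> \<eta> A = h \<cdot> \<eta> A" for g h A Y
    using universal_arrow_cancel[OF \<eta>[OF that(1)] that(2)] that Comp_in_Hom[OF \<eta>H[OF that(1)] that(3)]
    by (simp add: L_def)
  have "is_functor C (full_subcat C X) L"
    unfolding is_functor_def
  proof (intro conjI ballI allI)
    fix A assume A: "A \<in> Obj C"
    show "OMap L A \<in> Obj (full_subcat C X)" using LO[OF A] by simp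
    note I = Ident_in_Hom[OF A]
    show "AMap L (Ident C A) = Ident (full_subcat C X) (OMap L A)"
      using eqI[OF A LO[OF A] LA(1)[OF I] Ident_in_Hom[OF LO'[OF A]]] LA(2)[OF I]
        Comp_Ident_right[OF \<eta>H[OF A]] Comp_Ident_left[OF \<eta>H[OF A]] by simp
  next
    fix A B f assume f: "f \<in> Hom C A B"
    show "AMap L f \<in> Hom (full_subcat C X) (OMap L A) (OMap L B)"
      using LA[OF f] LO Hom_Obj[OF f] by simp
    fix K g assume g: "g \<in> Hom C B K"
    note O = Hom_Obj[OF f] Hom_Obj[OF g]
    have gf: "g \<cdot> f \<in> Hom C A K" by (rule Comp_in_Hom[OF f g])
    have "AMap L g \<cdot> AMap L f \<cdot> \<eta> A = AMap L g \<cdot> (\<eta> B \<cdot> f)"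
      using Comp_assoc[OF \<eta>H[OF O(1)] LA(1)[OF f] LA(1)[OF g]] LA(2)[OF f] by simp
    also have "\<dots> = \<eta> K \<cdot> g \<cdot> f"
      using Comp_assoc[OF f \<eta>H[OF O(2)] LA(1)[OF g]] LA(2)[OF g] by simp
    also have "\<dots> = AMap L (g \<cdot> f) \<cdot> \<eta> A"
      using Comp_assoc[OF f g \<eta>H[OF O(4)]] LA(2)[OF gf] by simp
    finally have "AMap L g \<cdot> AMap L f = AMap L (g \<cdot> f)"
      by (rule eqI[OF O(1) LO[OF O(4)] Comp_in_Hom[OF LA(1)[OF f] LA(1)[OF g]] LA(1)[OF gf]])
    then show "AMap L (g \<cdot> f) = AMap L g \<cdot>\<^bsub>full_subcat C X\<^esub> AMap L f" by simp
  qed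
  moreover have "is_functor (full_subcat C X) C incl_functor"
    using X by (auto simp: is_functor_def)
  moreover have "nat_trans C C incl_functor (functor_comp incl_functor L) \<eta>"
    using \<eta>H LA(2) by (simp add: nat_trans_def)
  moreover have "nat_trans (full_subcat C X) (full_subcat C X) (functor_comp L incl_functor) incl_functor \<epsilon>"
    unfolding nat_trans_def
  proof (intro conjI ballI allI)
    fix A assume "A \<in> Obj (full_subcat C X)"
    then show "\<epsilon> A \<in> Hom (full_subcat C X) (OMap (functor_comp L incl_functor) A) (OMap incl_functor A)"
      using \<epsilon>H LO X by auto
  next
    fix A B f assume "f \<in> Hom (full_subcat C X) A B"
    then have f: "f \<in> Hom C A B" and A: "A \<in> X" and B: "B \<in> X" by auto
    note O = Hom_Obj[OF f]
    have "\<epsilon> B \<cdot> AMap L f \<cdot> \<eta> A = \<epsilon> B \<cdot> \<eta> B \<cdot> f"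
      using Comp_assoc[OF \<eta>H[OF O(1)] LA(1)[OF f] \<epsilon>H(1)[OF B]]
        Comp_assoc[OF f \<eta>H[OF O(2)] \<epsilon>H(1)[OF B]] LA(2)[OF f] by simp
    also have "\<dots> = f \<cdot> \<epsilon> A \<cdot> \<eta> A"
      using Comp_assoc[OF \<eta>H[OF O(1)] \<epsilon>H(1)[OF A] f] \<epsilon>H(2) A B
        Comp_Ident_left[OF f] Comp_Ident_right[OF f] by simp
    finally have "\<epsilon> B \<cdot> AMap L f = f \<cdot> \<epsilon> A"
      by (rule eqI[OF O(1) B Comp_in_Hom[OF LA(1)[OF f] \<epsilon>H(1)[OF B]] Comp_in_Hom[OF \<epsilon>H(1)[OF A] f]])
    then show "\<epsilon> B \<cdot>\<^bsub>full_subcat C X\<^esub> AMap (functor_comp L incl_functor) f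
        = AMap incl_functor f \<cdot>\<^bsub>full_subcat C X\<^esub> \<epsilon> A" by simp
  qed
  moreover have "\<epsilon> (OMap L A) \<cdot> AMap L (\<eta> A) = Ident C (OMap L A)" if A: "A \<in> Obj C" for A
  proof -
    note L = LO[OF A] and \<eta>A = \<eta>H[OF A]
    have "\<epsilon> (OMap L A) \<cdot> AMap L (\<eta> A) \<cdot> \<eta> A = \<epsilon> (OMap L A) \<cdot> \<eta> (OMap L A) \<cdot> \<eta> A"
      using Comp_assoc[OF \<eta>A LA(1)[OF \<eta>A] \<epsilon>H(1)[OF L]]
        Comp_assoc[OF \<eta>A \<eta>H[OF LO'[OF A]] \<epsilon>H(1)[OF L]] LA(2)[OF \<eta>A] by simp
    also have "\<dots> = Ident C (OMap L A) \<cdot> \<eta> A" using \<epsilon>H(2)[OF L] by simp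
    finally show ?thesis
      by (rule eqI[OF A L Comp_in_Hom[OF LA(1)[OF \<eta>A] \<epsilon>H(1)[OF L]] Ident_in_Hom[OF LO'[OF A]]])
  qed
  ultimately have "reflection C X L \<eta> \<epsilon>"
    using \<epsilon>H(2) by (simp add: reflection_def adjunction_def)
  then show ?thesis by blast
qed

text \<open>Since \<open>r \<cdot> d\<close> and the identity agree after composing with
  \<open>r\<close>, the left inverse \<open>d\<close> is two-sided. It is then an isomorphism from
  an object of \<open>X\<close> to \<open>A\<close>, and repleteness applies to it.\<close>

lemma universal_arrow_left_inverse_imp_mem:
  assumes "X \<subseteq> Obj C" "replete C X" "universal_arrow C X A r"
    and d: "d \<in> Hom C (Cod C r) A" "d \<cdot> r = Ident C A"
  shows "A \<in> X"
proof -
  note r = universal_arrow_Hom[OF assms(3)] and R = universal_arrow_Cod[OF assms(3)]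
  have "r \<cdot> d \<cdot> r = r" using Comp_assoc[OF r d(1) r] d(2) Comp_Ident_right[OF r] by simp
  then have "r \<cdot> d = Ident C (Cod C r)"
    using universal_arrow_cancel[OF assms(3) R Comp_in_Hom[OF d(1) r] Ident_in_Hom[OF Hom_Obj(2)[OF r]]]
      Comp_Ident_left[OF r] r by simp
  then have "is_iso C d" using isoI[OF r d(1)] d(2) by simp
  then show ?thesis using assms(2) R d(1) by (auto simp: replete_def Hom_def)
qed

text \<open>The projections extend along \<open>\<eta> P\<close>, and the extensions form one map
  \<open>d\<close> back to \<open>P\<close>. Both \<open>d \<cdot> \<eta> P\<close> and the identity
  have the projections as components, so \<open>d\<close> is a left inverse of the unit.\<close>

lemma universal_arrows_imp_closed_under_products:
  assumes "X \<subseteq> Obj C" "replete C X" "\<And>A. A \<in> Obj C \<Longrightarrow> universal_arrow C X A (\<eta> A)"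
  shows "closed_under_products U C X"
  unfolding closed_under_products_def
proof (intro allI impI)
  fix I :: "'u set" and F P p
  assume "small U I \<and> (\<forall>i\<in>I. F i \<in> X) \<and> is_product C I F P p"
  then have F: "\<And>i. i \<in> I \<Longrightarrow> F i \<in> X" and P: "P \<in> Obj C" and p: "\<And>i. i \<in> I \<Longrightarrow> p i \<in> Hom C P (F i)"
    and ex: "\<And>W q. W \<in> Obj C \<Longrightarrow> (\<And>i. i \<in> I \<Longrightarrow> q i \<in> Hom C W (F i)) \<Longrightarrow>
        \<exists>!h. h \<in> Hom C W P \<and> (\<forall>i \<in> I. p i \<cdot> h = q i)"
    by (auto simp: is_product_def)
  note u = assms(3)[OF P]
  note r = universal_arrow_Hom[OF u]
  define q where "q = (\<lambda>i. universal_lift C (\<eta> P) (p i))"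
  have q: "q i \<in> Hom C (Cod C (\<eta> P)) (F i)" "q i \<cdot> \<eta> P = p i" if "i \<in> I" for i
    using universal_lift[OF u p F] that by (auto simp: q_def)
  obtain d where d: "d \<in> Hom C (Cod C (\<eta> P)) P" and pd: "\<And>i. i \<in> I \<Longrightarrow> p i \<cdot> d = q i"
    using ex[of "Cod C (\<eta> P)" q] q Hom_Obj[OF r] by blast
  have "p i \<cdot> (d \<cdot> \<eta> P) = p i" if "i \<in> I" for i
    using Comp_assoc[OF r d p[OF that]] pd[OF that] q[OF that] by simp
  moreover have "p i \<cdot> Ident C P = p i" if "i \<in> I" for i using Comp_Ident_right[OF p[OF that]] .
  ultimately have "d \<cdot> \<eta> P = Ident C P"
    using ex[of P p, OF P p] Comp_in_Hom[OF r d] Ident_in_Hom[OF P] by blast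
  then show "P \<in> X" using universal_arrow_left_inverse_imp_mem[OF assms(1,2) u d] by simp
qed

lemma complete_category_has_products:
  assumes "complete_category (U :: 'u itself) C" "small U I" "\<And>i. i \<in> I \<Longrightarrow> F i \<in> Obj C"
  obtains P p where "is_product C (I :: 'u set) F P p"
proof -
  \<comment> \<open>The discrete category on \<open>I\<close>: each index is its own identity.
    Composable arrows are equal, so returning either one is a correct composition.\<close>
  define J where "J = \<lparr>Obj = I, Arr = I, Dom = id, Cod = id, Ident = id, Comp = (\<lambda>g f. f)\<rparr>"
  define D where "D = \<lparr>OMap = F, AMap = (\<lambda>i. Ident C (F i))\<rparr>"
  have J: "Hom J i j = (if i = j then I \<inter> {i} else {})" for i j by (auto simp: J_def Hom_def)
  have "category J"
    by unfold_locales (auto simp: J split: if_splits, auto simp: J_def)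
  moreover have "is_functor J C D"
    using assms(3) Ident_in_Hom Comp_Ident_left[OF Ident_in_Hom]
    by (auto simp: is_functor_def J split: if_splits) (auto simp: J_def D_def)
  moreover have "small U (Obj J)" "small U (Arr J)"
    using assms(2) by (simp_all add: J_def)
  ultimately obtain P p where "is_limit J C D P p"
    using assms(1) unfolding complete_category_def by blast
  \<comment> \<open>All arrows of the diagram are identities, so a cone is just a family of
    arrows.\<close>
  moreover have "is_cone J C D W q \<longleftrightarrow> W \<in> Obj C \<and> (\<forall>i\<in>I. q i \<in> Hom C W (F i))" for W q
    using Comp_Ident_left by (auto simp: is_cone_def J_def D_def)
  ultimately have "is_product C I F P p"
    by (auto simp: is_limit_def is_product_def J_def)
  then show ?thesis by (rule that)
qed

end

section \<open>Small sets\<close>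

lemma small_subset: "small U S \<Longrightarrow> T \<subseteq> S \<Longrightarrow> small U T"
  unfolding small_def using subset_imp_lepoll lesspoll_trans1 by blast

text \<open>Products are indexed by subsets of \<open>'u\<close>, whereas the quotients of an object
  are sets of arrows; an injection into \<open>'u\<close> bridges the two.\<close>

lemma small_imp_indexed:
  fixes S :: "'s set"
  assumes "small (U :: 'u itself) S"
  obtains I :: "'u set" and k where "small U I" "S = k ` I"
proof -
  obtain j :: "'s \<Rightarrow> 'u" where j: "inj_on j S"
    using assms by (auto simp: small_def lesspoll_def lepoll_def)
  have "small U (j ` S)"
    using assms unfolding small_def by (meson image_lepoll lesspoll_trans1)
  moreover have "S = inv_into S j ` (j ` S)" using j by force
  ultimately show ?thesis by (rule that)
qed

section \<open>Factorization systems whose left class consists of epimorphisms\<close>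

locale factorization_category = category +
  fixes E M
  assumes factorization_system: "factorization_system C E M"
    and E_epi: "e \<in> E \<Longrightarrow> is_epi C e"
begin

lemma E_Arr: "e \<in> E \<Longrightarrow> e \<in> Arr C" and M_Arr: "m \<in> M \<Longrightarrow> m \<in> Arr C"
  and iso_E: "is_iso C f \<Longrightarrow> f \<in> E"
  and E_Comp: "e \<in> E \<Longrightarrow> e' \<in> E \<Longrightarrow> Cod C e = Dom C e' \<Longrightarrow> e' \<cdot> e \<in> E"
  using factorization_system unfolding factorization_system_def by blast+

lemma factorization:
  assumes "f \<in> Hom C A B"
  obtains K e m where "e \<in> E" "m \<in> M" "e \<in> Hom C A K" "m \<in> Hom C K B" "f = m \<cdot> e"
proof -
  obtain e m where em: "e \<in> E" "m \<in> M" "Cod C e = Dom C m" "f = m \<cdot> e"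
    using factorization_system assms unfolding factorization_system_def Hom_def by blast
  then have e: "e \<in> Hom C (Dom C e) (Cod C e)" and m: "m \<in> Hom C (Cod C e) (Cod C m)"
    using E_Arr M_Arr by (auto simp: Hom_def)
  \<comment> \<open>The outer ends of the factorization are read off from the composite, whose
    domain and codomain are determined.\<close>
  then have "f \<in> Hom C (Dom C e) (Cod C m)" using Comp_in_Hom em by blast
  then have "Dom C e = A" "Cod C m = B" using assms by (auto simp: Hom_def)
  then show ?thesis using that em e m by simp
qed

lemma diagonal:
  assumes "e \<in> E" "m \<in> M" "e \<in> Hom C A B" "m \<in> Hom C K D" "f \<in> Hom C A K" "g \<in> Hom C B D"
    and "g \<cdot> e = m \<cdot> f"
  obtains d where "d \<in> Hom C B K" "d \<cdot> e = f" "m \<cdot> d = g"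
proof -
  have eqs: "Dom C e = A" "Cod C e = B" "Dom C m = K" "Cod C m = D"
    using assms(3,4) by (auto simp: Hom_def)
  have "\<forall>e \<in> E. \<forall>m \<in> M.
      \<forall>f \<in> Hom C (Dom C e) (Dom C m). \<forall>g \<in> Hom C (Cod C e) (Cod C m). g \<cdot> e = m \<cdot> f \<longrightarrow>
      (\<exists>!d. d \<in> Hom C (Cod C e) (Dom C m) \<and> d \<cdot> e = f \<and> m \<cdot> d = g)"
    using factorization_system unfolding factorization_system_def by (elim conjE)
  from this[rule_format, OF assms(1,2), unfolded eqs, OF assms(5-7)] show ?thesis
    using that by blast
qed

text \<open>Extend \<open>m\<close> along the unit at its domain. The unit, \<open>m\<close>, this
  extension and the identity form a commutative square, whose diagonal is a left inverse of the
  unit.\<close>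

lemma E_universal_arrows_imp_closed_under_subobjects:
  assumes "X \<subseteq> Obj C" "replete C X" "\<And>A. A \<in> Obj C \<Longrightarrow> universal_arrow C X A (\<eta> A)"
    and "\<And>A. A \<in> Obj C \<Longrightarrow> \<eta> A \<in> E"
  shows "closed_under_subobjects C M X"
  unfolding closed_under_subobjects_def
proof (intro ballI impI)
  fix m assume m: "m \<in> M" and X: "Cod C m \<in> X"
  let ?A = "Dom C m"
  have mH: "m \<in> Hom C ?A (Cod C m)" using M_Arr[OF m] by (simp add: Hom_def)
  then have A: "?A \<in> Obj C" by (rule Hom_Obj)
  note u = assms(3)[OF A]
  note l = universal_lift[OF u mH X]
  obtain d where "d \<in> Hom C (Cod C (\<eta> ?A)) ?A" "d \<cdot> \<eta> ?A = Ident C ?A"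
    using diagonal[OF assms(4)[OF A] m universal_arrow_Hom[OF u] mH Ident_in_Hom[OF A] l(1)]
      l(2) Comp_Ident_right[OF mH] by metis
  then show "?A \<in> X" using universal_arrow_left_inverse_imp_mem[OF assms(1,2) u] by simp
qed

text \<open>The middle object of \<open>r = m \<cdot> e\<close> is an \<open>M\<close>-subobject of
  an object of \<open>X\<close>, so \<open>e\<close> extends along \<open>r\<close> to some
  \<open>h\<close>. Then \<open>h\<close> is a right inverse of \<open>m\<close> by universality of
  \<open>r\<close>, and a left inverse because \<open>e\<close> is epi. Hence \<open>m\<close> is an
  isomorphism and lies in \<open>E\<close>.\<close>

lemma universal_arrow_in_E:
  assumes "X \<subseteq> Obj C" "closed_under_subobjects C M X" "universal_arrow C X A r"
  shows "r \<in> E"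
proof -
  note rH = universal_arrow_Hom[OF assms(3)] and R = universal_arrow_Cod[OF assms(3)]
  obtain K e m where e: "e \<in> E" "e \<in> Hom C A K" and m: "m \<in> M" "m \<in> Hom C K (Cod C r)" and r: "r = m \<cdot> e"
    using factorization[OF rH] by metis
  have K: "K \<in> X" using assms(2) m R by (auto simp: closed_under_subobjects_def Hom_def)
  define h where "h = universal_lift C r e"
  have h: "h \<in> Hom C (Cod C r) K" "h \<cdot> r = e"
    using universal_lift[OF assms(3) e(2) K] by (auto simp: h_def)
  have "m \<cdot> h \<cdot> r = Ident C (Cod C r) \<cdot> r"
    using Comp_assoc[OF rH h(1) m(2)] h(2) r Comp_Ident_left[OF rH] by simp
  then have mh: "m \<cdot> h = Ident C (Cod C r)"
    using universal_arrow_cancel[OF assms(3) R Comp_in_Hom[OF h(1) m(2)] Ident_in_Hom[OF Hom_Obj(2)[OF rH]]]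
      Comp_Ident_left[OF rH] rH by simp
  have "h \<cdot> m \<cdot> e = Ident C K \<cdot> e"
    using Comp_assoc[OF e(2) m(2) h(1)] h(2) r Comp_Ident_left[OF e(2)] by simp
  then have "h \<cdot> m = Ident C K"
    using epi_cancel[OF E_epi[OF e(1)] e(2) Comp_in_Hom[OF m(2) h(1)] Ident_in_Hom[OF Hom_Obj(2)[OF e(2)]]]
    by simp
  then have "is_iso C m" using isoI[OF m(2) h(1)] mh by simp
  then show ?thesis using E_Comp[OF e(1) iso_E] e(2) m(2) r by (auto simp: Hom_def)
qed

text \<open>A solution set argument: the representatives \<open>q\<close> are a small weakly initial
  family among the arrows from \<open>A\<close> into \<open>X\<close>, and the \<open>E\<close>-part
  of the induced map to their product is a single weakly initial arrow. Being epi, it is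
  universal.\<close>

lemma E_universal_arrow_exists:
  fixes U :: "'u itself"
  assumes X: "X \<subseteq> Obj C" and A: "A \<in> Obj C"
    and complete: "complete_category U C" and cwp: "co_well_powered U C E"
    and prod: "closed_under_products U C X" and sub: "closed_under_subobjects C M X"
  obtains r where "r \<in> E" "universal_arrow C X A r"
proof -
  \<comment> \<open>A class is kept once some member has its codomain in \<open>X\<close>;
    \<open>q\<close> chooses such a member.\<close>
  let ?S = "{c \<in> morphisms_from C E A // quotient_equiv C E A. \<exists>e \<in> c. Cod C e \<in> X}"
  have "small U (morphisms_from C E A // quotient_equiv C E A)"
    using cwp A by (simp add: co_well_powered_def)
  then have "small U ?S" by (rule small_subset) blast
  then obtain I :: "'u set" and k where I: "small U I" "?S = k ` I" by (rule small_imp_indexed)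
  define q where "q = (\<lambda>i. SOME e. e \<in> k i \<and> Cod C e \<in> X)"
  have q: "q i \<in> k i" "Cod C (q i) \<in> X" if "i \<in> I" for i
  proof -
    have "k i \<in> ?S" using I(2) that by simp
    then have "\<exists>e. e \<in> k i \<and> Cod C e \<in> X" by blast
    from someI_ex[OF this] show "q i \<in> k i" "Cod C (q i) \<in> X" by (simp_all add: q_def)
  qed
  have qH: "q i \<in> Hom C A (Cod C (q i))" if "i \<in> I" for i
  proof -
    have "k i \<in> morphisms_from C E A // quotient_equiv C E A" using I(2) that by blast
    with q(1)[OF that] have "q i \<in> morphisms_from C E A"
      by (auto simp: quotient_def quotient_equiv_def)
    then show ?thesis using E_Arr by (auto simp: morphisms_from_def Hom_def)
  qed
  obtain P p where P: "is_product C I (\<lambda>i. Cod C (q i)) P p"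
    using complete_category_has_products[OF complete I(1), of "\<lambda>i. Cod C (q i)"] q(2) X by blast
  have PX: "P \<in> X"
    using prod[unfolded closed_under_products_def, rule_format, of I "\<lambda>i. Cod C (q i)"] I(1) q(2) P by blast
  have p: "p i \<in> Hom C P (Cod C (q i))" if "i \<in> I" for i using P that by (simp add: is_product_def)
  obtain f where f: "f \<in> Hom C A P" and pf: "\<And>i. i \<in> I \<Longrightarrow> p i \<cdot> f = q i"
    using P A qH unfolding is_product_def by metis
  obtain R r m where r: "r \<in> E" "r \<in> Hom C A R" and m: "m \<in> M" "m \<in> Hom C R P" and fr: "f = m \<cdot> r"
    using factorization[OF f] by metis
  have R: "R \<in> X" using sub m PX by (auto simp: closed_under_subobjects_def Hom_def)
  have Cod: "Cod C r = R" using r(2) by (simp add: Hom_def)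
  have "\<exists>!g. g \<in> Hom C R Y \<and> g \<cdot> r = t" if Y: "Y \<in> X" and t: "t \<in> Hom C A Y" for Y t
  proof -
    obtain K e n where e: "e \<in> E" "e \<in> Hom C A K" and n: "n \<in> M" "n \<in> Hom C K Y" and tn: "t = n \<cdot> e"
      using factorization[OF t] by metis
    have K: "K \<in> X" using sub n Y by (auto simp: closed_under_subobjects_def Hom_def)
    \<comment> \<open>The class of the \<open>E\<close>-part of \<open>t\<close> is one of those
      kept, because \<open>K\<close> lies in \<open>X\<close>.\<close>
    let ?c = "quotient_equiv C E A `` {e}"
    have eA: "e \<in> morphisms_from C E A" using e by (simp add: morphisms_from_def Hom_def)
    note IK = Ident_in_Hom[OF Hom_Obj(2)[OF e(2)]]
    have "is_iso C (Ident C K)" using isoI[OF IK IK] Comp_Ident_left[OF IK] by simp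
    then have "e \<in> ?c"
      using eA IK Comp_Ident_left[OF e(2)] e(2) by (auto simp: quotient_equiv_def Hom_def)
    then have "?c \<in> ?S" using eA K e(2) by (auto simp: quotient_def Hom_def)
    then obtain i where i: "i \<in> I" "?c = k i" using I(2) by auto
    then obtain h where "h \<in> Hom C (Cod C e) (Cod C (q i))" and iso: "is_iso C h" and he: "h \<cdot> e = q i"
      using q(1)[OF i(1)] by (auto simp: quotient_equiv_def)
    then have h: "h \<in> Hom C K (Cod C (q i))" using e(2) by (simp add: Hom_def)
    then obtain h' where h': "h' \<in> Hom C (Cod C (q i)) K" "h' \<cdot> h = Ident C K"
      using iso by (auto simp: is_iso_def Hom_def)
    have pm: "p i \<cdot> m \<in> Hom C R (Cod C (q i))" by (rule Comp_in_Hom[OF m(2) p[OF i(1)]])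
    \<comment> \<open>The path runs from \<open>R\<close> through the product, its factor at
      \<open>i\<close> and \<open>K\<close> to \<open>Y\<close>.\<close>
    let ?g = "n \<cdot> (h' \<cdot> (p i \<cdot> m))"
    have g': "h' \<cdot> (p i \<cdot> m) \<in> Hom C R K" by (rule Comp_in_Hom[OF pm h'(1)])
    have g: "?g \<in> Hom C R Y" by (rule Comp_in_Hom[OF g' n(2)])
    \<comment> \<open>Both sides equal \<open>q i\<close>; cancelling \<open>h\<close> by
      \<open>h'\<close> then gives \<open>e\<close>.\<close>
    have "p i \<cdot> m \<cdot> r = h \<cdot> e" using Comp_assoc[OF r(2) m(2) p[OF i(1)]] fr pf[OF i(1)] he by simp
    then have "h' \<cdot> (p i \<cdot> m) \<cdot> r = e"
      using Comp_assoc[OF r(2) pm h'(1)] Comp_assoc[OF e(2) h h'(1)] h'(2) Comp_Ident_left[OF e(2)] by simp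
    then have "?g \<cdot> r = t" using Comp_assoc[OF r(2) g' n(2)] tn by simp
    then show ?thesis using g epi_cancel[OF E_epi[OF r(1)] r(2)] by blast
  qed
  then have "universal_arrow C X A r" using r R Cod by (simp add: universal_arrow_def)
  with r(1) show ?thesis by (rule that)
qed

end

section \<open>Equivalence of the closure conditions with reflectivity\<close>

theorem theorem4p1:
  fixes U :: "'u itself"
    and C :: "('o, 'a) cat"
    and E M :: "'a set"
    and X :: "'o set"
  assumes "category C"
    and "complete_category U C"
    and "factorization_system C E M"
    and "\<forall>e \<in> E. is_epi C e"
    and "co_well_powered U C E"
    and "X \<subseteq> Obj C"
    and "replete C X"
  shows "((closed_under_products U C X \<and> closed_under_subobjects C M X)
            \<longleftrightarrow> (\<exists>L \<eta> \<epsilon>. reflection C X L \<eta> \<epsilon> \<and> (\<forall>A \<in> Obj C. \<eta> A \<in> E)))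
       \<and> ((\<exists>L \<eta> \<epsilon>. reflection C X L \<eta> \<epsilon> \<and> (\<forall>A \<in> Obj C. \<eta> A \<in> E))
            \<longleftrightarrow> (reflective C X \<and> closed_under_subobjects C M X))"
    (is "(?i \<longleftrightarrow> ?ii) \<and> (_ \<longleftrightarrow> ?iii)")
proof -
  interpret factorization_category C E M
    using assms(1,3,4) by (simp add: factorization_category_def factorization_category_axioms_def)
  have "?ii" if ?i
  proof -
    have "\<forall>A \<in> Obj C. \<exists>r. r \<in> E \<and> universal_arrow C X A r"
      using E_universal_arrow_exists[OF assms(6) _ assms(2,5)] that by metis
    then obtain \<eta> where "\<forall>A \<in> Obj C. \<eta> A \<in> E \<and> universal_arrow C X A (\<eta> A)" by metis
    then show ?thesis using universal_arrows_imp_reflection[OF assms(6)] by blast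
  qed
  moreover have "?i \<and> ?iii" if ii: ?ii
  proof -
    obtain L \<eta> \<epsilon> where r: "reflection C X L \<eta> \<epsilon>" and \<eta>: "\<And>A. A \<in> Obj C \<Longrightarrow> \<eta> A \<in> E"
      using ii by blast
    note u = reflection_imp_universal_arrow[OF r]
    have "closed_under_products U C X"
      by (rule universal_arrows_imp_closed_under_products[OF assms(6,7) u])
    moreover have "closed_under_subobjects C M X"
      by (rule E_universal_arrows_imp_closed_under_subobjects[OF assms(6,7) u \<eta>])
    ultimately show ?thesis using r by (auto simp: reflective_def)
  qed
  \<comment> \<open>The given reflection serves unchanged, since its unit consists of universal
    arrows and these lie in \<open>E\<close>.\<close>
  moreover have "?ii" if ?iii
    using that universal_arrow_in_E[OF assms(6)] reflection_imp_universal_arrow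
    unfolding reflective_def by blast
  ultimately show ?thesis by blast
qed

end
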